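(* Let $t\ge 2$ be an integer and let $P_t$ be the path graph on $t$ vertices. If $\Gamma$ is a finite simple graph with $A(\Gamma;x)=A(P_t;x)$, then $\Gamma$ is isomorphic to $P_t$.
   Context: All graphs are finite and simple with at least one vertex. For a graph $\Gamma=(V,E)$ of order $n$, a vertex $v$ and $X\subseteq V$, let $\delta_X(v)$ be the number of neighbours of $v$ in $X$, $\delta(v)=\delta_V(v)$, $\delta_1$ the maximum degree, and $\bar S=V\setminus S$. Let $\mathcal{K}=[-\delta_1,\delta_1]\cap\mathbb{Z}$. A nonempty $S\subseteq V$ is a defensive $k$-alliance if $\delta_S(v)\ge\delta_{\bar S}(v)+k$ for all $v\in S$. The exact index of alliance of a nonempty $S$ is $k_S=\max\{k\in\mathcal{K}: S \text{ is a defensive } k\text{-alliance}\}$ (equivalently $k_S=\min_{v\in S}(\delta_S(v)-\delta_{\bar S}(v))$). The alliance polynomial is $A(\Gamma;x)=\sum_{S} x^{n+k_S}$, the sum over all nonempty $S\subseteq V$ whose induced subgraph $\langle S\rangle$ is connected. *)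

theory Defs
  imports "Graph_Theory.Digraph_Isomorphism" "HOL-Computational_Algebra.Polynomial"
begin

text \<open>
  A finite simple graph is a \<^locale>\<open>pair_graph\<close>: a finite, loop-free symmetric digraph whose
  arcs are pairs of vertices. An edge between \<open>u\<close> and \<open>v\<close> is the pair of arcs \<open>(u, v)\<close> and \<open>(v, u)\<close>.
\<close>

definition deg_in :: "'a pair_pre_digraph \<Rightarrow> 'a set \<Rightarrow> 'a \<Rightarrow> nat" where
  "deg_in G X v = card {u \<in> X. (v, u) \<in> parcs G}"

definition max_deg :: "'a pair_pre_digraph \<Rightarrow> nat" where
  "max_deg G = Max (deg_in G (pverts G) ` pverts G)"

definition defensive_alliance :: "'a pair_pre_digraph \<Rightarrow> int \<Rightarrow> 'a set \<Rightarrow> bool" where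
  "defensive_alliance G k S \<longleftrightarrow>
     S \<noteq> {} \<and> S \<subseteq> pverts G \<and>
     (\<forall>v\<in>S. int (deg_in G S v) \<ge> int (deg_in G (pverts G - S) v) + k)"

text \<open>
  The maximum is over a finite set; for a nonempty set \<open>S\<close> of vertices of a finite graph that set
  is nonempty, because it contains \<open>- max_deg G\<close>.
\<close>

definition exact_index :: "'a pair_pre_digraph \<Rightarrow> 'a set \<Rightarrow> int" where
  "exact_index G S =
     Max {k. - int (max_deg G) \<le> k \<and> k \<le> int (max_deg G) \<and> defensive_alliance G k S}"

text \<open>
  The exponent is at least \<open>card (pverts G) - max_deg G > 0\<close> in a graph with at least one vertex,
  so the conversion by \<^const>\<open>nat\<close> loses nothing.
\<close>

definition alliance_poly :: "'a pair_pre_digraph \<Rightarrow> int poly" where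
  "alliance_poly G =
     (\<Sum>S\<in>{S. S \<subseteq> pverts G \<and> S \<noteq> {} \<and> connected (with_proj G \<restriction> S)}.
        monom 1 (nat (int (card (pverts G)) + exact_index G S)))"

definition path_graph :: "nat \<Rightarrow> nat pair_pre_digraph" where
  "path_graph t =
     \<lparr>pverts = {..<t}, parcs = {(i, j). i < t \<and> j < t \<and> (j = Suc i \<or> i = Suc j)}\<rparr>"

end

theory Submission
  imports Defs
begin

text \<open>
  Let \<open>n\<close> be the order and \<open>\<Delta>\<close> the maximum degree. Singletons show that the lowest exponent of the
  alliance polynomial is \<open>n - \<Delta>\<close>, so \<open>n - \<Delta>\<close> agrees for \<open>\<Gamma>\<close> and \<open>P\<^sub>t\<close>. A component of \<open>\<Gamma>\<close> with an edge
  contributes an exponent above \<open>n\<close>, while the top exponent \<open>t + 1\<close> is at most \<open>n + \<Delta>\<close>; this forces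
  \<open>n = t\<close> and \<open>\<Delta> \<le> 2\<close>. When \<open>\<Delta> \<le> 2\<close>, the connected sets of negative index are exactly the
  non-isolated singletons, so \<open>\<Gamma>\<close> has no isolated vertex. Then every component has positive index,
  but only one connected set has index \<open>1\<close> and none has index \<open>2\<close>: hence \<open>\<Gamma>\<close> is connected, has a
  vertex of degree \<open>1\<close>, and walking from that vertex enumerates it as a path.
\<close>

section \<open>Connected and arc-closed vertex sets\<close>

definition conn_sets :: "'a pair_pre_digraph \<Rightarrow> 'a set set" where
  "conn_sets G = {S. S \<subseteq> pverts G \<and> S \<noteq> {} \<and> connected (with_proj G \<restriction> S)}"

text \<open>In a graph of order n, the size of this family is the coefficient of x^(n+k) in the
  alliance polynomial.\<close>

definition conn_sets_index :: "'a pair_pre_digraph \<Rightarrow> int \<Rightarrow> 'a set set" where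
  "conn_sets_index G k = {S \<in> conn_sets G. exact_index G S = k}"

text \<open>Since arcs are symmetric, these sets are the unions of connected components, the empty
  union included.\<close>

definition arc_closed :: "'a pair_pre_digraph \<Rightarrow> 'a set \<Rightarrow> bool" where
  "arc_closed G T \<longleftrightarrow> T \<subseteq> pverts G \<and> (\<forall>u\<in>T. \<forall>v. (u, v) \<in> parcs G \<longrightarrow> v \<in> T)"

lemma conn_setsD:
  assumes "S \<in> conn_sets G" shows "S \<subseteq> pverts G" "S \<noteq> {}"
  using assms by (simp_all add: conn_sets_def)

context pair_graph
begin

abbreviation vdeg :: "'a \<Rightarrow> nat" where
  "vdeg \<equiv> deg_in G (pverts G)"

section \<open>Degrees, alliance indices and coefficients\<close>

lemma arc_commute: "(u, v) \<in> parcs G \<longleftrightarrow> (v, u) \<in> parcs G"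
  using arcs_symmetric by blast

lemma finite_nbrs: "S \<subseteq> pverts G \<Longrightarrow> finite {u \<in> S. (v, u) \<in> parcs G}"
  using pair_finite_verts by (auto intro: finite_subset)

lemma deg_in_split:
  assumes "S \<subseteq> pverts G"
  shows "vdeg v = deg_in G S v + deg_in G (pverts G - S) v"
proof -
  have "{u \<in> pverts G. (v, u) \<in> parcs G} =
      {u \<in> S. (v, u) \<in> parcs G} \<union> {u \<in> pverts G - S. (v, u) \<in> parcs G}"
    using assms by auto
  then show ?thesis
    unfolding deg_in_def
    by (simp only:) (rule card_Un_disjoint; use assms in \<open>auto intro: finite_nbrs\<close>)
qed

lemma vdeg_le_max_deg: "v \<in> pverts G \<Longrightarrow> vdeg v \<le> max_deg G"
  unfolding max_deg_def using pair_finite_verts by (intro Max_ge) auto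

lemma vdeg_less_card:
  assumes "v \<in> pverts G" shows "vdeg v < card (pverts G)"
  unfolding deg_in_def using assms pair_finite_verts no_loops' by (intro psubset_card_mono) auto

lemma max_deg_attained:
  assumes "pverts G \<noteq> {}" obtains v where "v \<in> pverts G" "vdeg v = max_deg G"
proof -
  have "max_deg G \<in> vdeg ` pverts G"
    unfolding max_deg_def using assms pair_finite_verts by (intro Max_in) auto
  then show ?thesis using that by auto
qed

lemma defensive_alliance_mono:
  "defensive_alliance G k S \<Longrightarrow> j \<le> k \<Longrightarrow> defensive_alliance G j S"
  unfolding defensive_alliance_def by force

lemma defensive_alliance_low:
  assumes "S \<subseteq> pverts G" "S \<noteq> {}" "k \<le> - int (max_deg G)"
  shows "defensive_alliance G k S"
  unfolding defensive_alliance_def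
proof (intro conjI ballI)
  fix v assume "v \<in> S"
  then show "int (deg_in G S v) \<ge> int (deg_in G (pverts G - S) v) + k"
    using deg_in_split[OF assms(1), of v] vdeg_le_max_deg[of v] assms by auto
qed (use assms in auto)

lemma defensive_alliance_le_max_deg:
  assumes "defensive_alliance G k S"
  shows "k \<le> int (max_deg G)"
proof -
  obtain v where v: "v \<in> S" "S \<subseteq> pverts G" "int (deg_in G S v) \<ge> int (deg_in G (pverts G - S) v) + k"
    using assms unfolding defensive_alliance_def by blast
  then show ?thesis
    using deg_in_split[of S v] vdeg_le_max_deg[of v] by auto
qed

text \<open>Restricting k to [-\<Delta>, \<Delta>] cuts nothing off: a defensive k-alliance forces k
  \<le> \<Delta>, and every nonempty set is one for k \<le> -\<Delta>. Hence the equivalence holds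
  for all integers k, and later an index is determined through its lower bounds rather than through
  \<open>Max\<close>.\<close>

lemma exact_index_ge_iff:
  assumes "S \<subseteq> pverts G" "S \<noteq> {}"
  shows "k \<le> exact_index G S \<longleftrightarrow> defensive_alliance G k S"
    and "- int (max_deg G) \<le> exact_index G S"
    and "exact_index G S \<le> int (max_deg G)"
proof -
  define K where
    "K = {k. - int (max_deg G) \<le> k \<and> k \<le> int (max_deg G) \<and> defensive_alliance G k S}"
  have fin: "finite K"
    by (rule finite_subset[of _ "{- int (max_deg G)..int (max_deg G)}"]) (auto simp: K_def)
  have low: "- int (max_deg G) \<in> K"
    using defensive_alliance_low[OF assms] by (auto simp: K_def)
  have ex: "exact_index G S = Max K" by (simp add: exact_index_def K_def)
  have mem: "exact_index G S \<in> K" using ex fin low Max_in[of K] by (metis empty_iff)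
  then show "- int (max_deg G) \<le> exact_index G S" "exact_index G S \<le> int (max_deg G)"
    by (auto simp: K_def)
  show "k \<le> exact_index G S \<longleftrightarrow> defensive_alliance G k S"
  proof
    assume "k \<le> exact_index G S"
    then show "defensive_alliance G k S"
      using mem defensive_alliance_mono by (auto simp: K_def)
  next
    assume k: "defensive_alliance G k S"
    show "k \<le> exact_index G S"
    proof (cases "k \<ge> - int (max_deg G)")
      case True
      then have "k \<in> K" using k defensive_alliance_le_max_deg[OF k] by (auto simp: K_def)
      then show ?thesis using ex fin by simp
    next
      case False
      then show ?thesis using mem by (auto simp: K_def)
    qed
  qed
qed

text \<open>No vertex of S has a neighbour outside S, so the index is the minimum degree over
  S.\<close>

lemma exact_index_closed:
  assumes "arc_closed G S" "S \<noteq> {}"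
  shows "k \<le> exact_index G S \<longleftrightarrow> (\<forall>v\<in>S. k \<le> int (vdeg v))"
proof -
  have S: "S \<subseteq> pverts G" using assms by (auto simp: arc_closed_def)
  have "deg_in G (pverts G - S) v = 0" if "v \<in> S" for v
    using that assms(1) by (auto simp: arc_closed_def deg_in_def)
  moreover from this have "deg_in G S v = vdeg v" if "v \<in> S" for v
    using deg_in_split[OF S, of v] that by simp
  ultimately show ?thesis
    using S assms(2) by (auto simp: exact_index_ge_iff(1) defensive_alliance_def)
qed

lemma exact_index_singleton:
  assumes "v \<in> pverts G" shows "exact_index G {v} = - int (vdeg v)"
proof -
  have "deg_in G {v} v = 0" using no_loops' by (auto simp: deg_in_def)
  moreover from this have "deg_in G (pverts G - {v}) v = vdeg v"
    using deg_in_split[of "{v}" v] assms by simp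
  ultimately have "k \<le> exact_index G {v} \<longleftrightarrow> k \<le> - int (vdeg v)" for k
    using assms by (subst exact_index_ge_iff(1)) (auto simp: defensive_alliance_def)
  then show ?thesis by (meson order_antisym order_refl)
qed

lemma finite_conn_sets: "finite (conn_sets G)"
  by (rule finite_subset[of _ "Pow (pverts G)"]) (auto dest: conn_setsD simp: pair_finite_verts)

lemma coeff_alliance_poly:
  "coeff (alliance_poly G) m = int (card (conn_sets_index G (int m - int (card (pverts G)))))"
proof -
  let ?n = "card (pverts G)"
  \<comment> \<open>As \<Delta> < n, no exponent is truncated by \<open>nat\<close>, so different
    indices give different exponents.\<close>
  have nonneg: "0 \<le> int ?n + exact_index G S" if S: "S \<in> conn_sets G" for S
  proof -
    from S have S': "S \<subseteq> pverts G" "S \<noteq> {}" by (rule conn_setsD)+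
    then have "pverts G \<noteq> {}" by auto
    then obtain v where "v \<in> pverts G" "vdeg v = max_deg G" by (rule max_deg_attained)
    then show ?thesis using exact_index_ge_iff(2)[OF S'] vdeg_less_card[of v] by linarith
  qed
  have "coeff (alliance_poly G) m =
      (\<Sum>S\<in>conn_sets G. if nat (int ?n + exact_index G S) = m then 1 else 0)"
    unfolding alliance_poly_def conn_sets_def coeff_sum by (simp add: coeff_monom)
  also have "\<dots> = (\<Sum>S\<in>conn_sets G. if exact_index G S = int m - int ?n then 1 else 0)"
  proof (rule sum.cong[OF refl])
    fix S assume "S \<in> conn_sets G"
    then have "nat (int ?n + exact_index G S) = m \<longleftrightarrow> exact_index G S = int m - int ?n"
      using nonneg[of S] by linarith
    then show "(if nat (int ?n + exact_index G S) = m then 1 else 0 :: int) =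
        (if exact_index G S = int m - int ?n then 1 else 0)" by simp
  qed
  also have "\<dots> = int (card (conn_sets_index G (int m - int ?n)))"
    using finite_conn_sets by (simp add: sum.If_cases conn_sets_index_def Int_def)
  finally show ?thesis .
qed

lemma conn_sets_index_empty:
  assumes "k < - int (max_deg G) \<or> int (max_deg G) < k"
  shows "conn_sets_index G k = {}"
proof -
  have "exact_index G S \<noteq> k" if "S \<in> conn_sets G" for S
    using assms exact_index_ge_iff(2,3)[OF conn_setsD[OF that]] by auto
  then show ?thesis by (auto simp: conn_sets_index_def)
qed

lemma max_deg_less_card:
  "pverts G \<noteq> {} \<Longrightarrow> max_deg G < card (pverts G)"
  by (metis max_deg_attained vdeg_less_card)

section \<open>Connectedness through cuts, and components\<close>

lemma connected_induce_iff:
  assumes S: "S \<subseteq> pverts G" "S \<noteq> {}"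
  shows "connected (with_proj G \<restriction> S) \<longleftrightarrow>
    (\<forall>T. T \<subseteq> S \<longrightarrow> T \<noteq> {} \<longrightarrow> (\<forall>u\<in>T. \<forall>v\<in>S. (u, v) \<in> parcs G \<longrightarrow> v \<in> T) \<longrightarrow> T = S)"
    (is "_ \<longleftrightarrow> ?cut")
proof -
  let ?R = "rtrancl_on S ({(u, v) \<in> parcs G. u \<in> S \<and> v \<in> S})"
  \<comment> \<open>The arcs are symmetric already, so the symmetric closure adds none.\<close>
  have ends: "(arcs_ends (with_proj G \<restriction> S))\<^sup>s = {(u, v) \<in> parcs G. u \<in> S \<and> v \<in> S}"
  proof -
    have "arcs_ends (with_proj G \<restriction> S) = {(u, v) \<in> parcs G. u \<in> S \<and> v \<in> S}"
      by (force simp: arcs_ends_conv)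
    moreover have "(\<lambda>(a, b). (b, a)) ` {(u, v) \<in> parcs G. u \<in> S \<and> v \<in> S} \<subseteq> {(u, v) \<in> parcs G. u \<in> S \<and> v \<in> S}"
      using arcs_symmetric by auto
    ultimately show ?thesis unfolding symcl_def by (simp add: Un_absorb2)
  qed
  have conv: "connected (with_proj G \<restriction> S) \<longleftrightarrow> (\<forall>u\<in>S. \<forall>v\<in>S. (u, v) \<in> ?R)"
    using S(2) by (simp add: connected_conv ends)
  show ?thesis
  proof
    assume con: "connected (with_proj G \<restriction> S)"
    show ?cut
    proof (intro allI impI)
      fix T assume T: "T \<subseteq> S" "T \<noteq> {}" "\<forall>u\<in>T. \<forall>v\<in>S. (u, v) \<in> parcs G \<longrightarrow> v \<in> T"
      then obtain u where u: "u \<in> T" by blast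
      have "v \<in> T" if "v \<in> S" for v
      proof -
        have "(u, v) \<in> ?R" using con conv u T(1) that by blast
        then show ?thesis by (induct rule: rtrancl_on_induct) (use u T in auto)
      qed
      then show "T = S" using T(1) by blast
    qed
  next
    assume cut: ?cut
    have "(u, v) \<in> ?R" if "u \<in> S" "v \<in> S" for u v
    proof -
      \<comment> \<open>The vertices reachable from u inside S form a nonempty set that no arc
        within S leaves, so the cut condition makes it all of S.\<close>
      have "{w. (u, w) \<in> ?R} = S"
      proof (rule cut[rule_format])
        show "{w. (u, w) \<in> ?R} \<subseteq> S" by (auto dest: in_rtrancl_on_in_F)
        show "{w. (u, w) \<in> ?R} \<noteq> {}" using that by auto
      next
        fix x y assume "x \<in> {w. (u, w) \<in> ?R}" "y \<in> S" "(x, y) \<in> parcs G"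
        then show "y \<in> {w. (u, w) \<in> ?R}"
          by (auto dest: in_rtrancl_on_in_F intro: rtrancl_on_into_rtrancl_on)
      qed
      then show ?thesis using that by blast
    qed
    then show "connected (with_proj G \<restriction> S)" using conv by blast
  qed
qed

lemma conn_sets_iff:
  "S \<in> conn_sets G \<longleftrightarrow> S \<subseteq> pverts G \<and> S \<noteq> {} \<and>
    (\<forall>T. T \<subseteq> S \<longrightarrow> T \<noteq> {} \<longrightarrow> (\<forall>u\<in>T. \<forall>v\<in>S. (u, v) \<in> parcs G \<longrightarrow> v \<in> T) \<longrightarrow> T = S)"
  unfolding conn_sets_def using connected_induce_iff by blast

lemma verts_conn_sets_iff:
  "pverts G \<in> conn_sets G \<longleftrightarrow>
    pverts G \<noteq> {} \<and> (\<forall>T. T \<noteq> {} \<longrightarrow> arc_closed G T \<longrightarrow> T = pverts G)"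
proof -
  have "arc_closed G T \<longleftrightarrow> T \<subseteq> pverts G \<and> (\<forall>u\<in>T. \<forall>v\<in>pverts G. (u, v) \<in> parcs G \<longrightarrow> v \<in> T)" for T
    unfolding arc_closed_def using in_arcsD2 by blast
  then show ?thesis unfolding conn_sets_iff by (simp; blast)
qed

lemma singleton_conn_sets: "v \<in> pverts G \<Longrightarrow> {v} \<in> conn_sets G"
  by (auto simp: conn_sets_iff)

text \<open>The singleton of a vertex of maximum degree is a witness. Together with
  \<open>conn_sets_index_empty\<close>, this makes n - \<Delta> the lowest exponent of the
  polynomial.\<close>

lemma conn_sets_index_lowest:
  assumes "pverts G \<noteq> {}" shows "conn_sets_index G (- int (max_deg G)) \<noteq> {}"
proof -
  obtain v where "v \<in> pverts G" "vdeg v = max_deg G" using assms by (rule max_deg_attained)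
  then have "{v} \<in> conn_sets_index G (- int (max_deg G))"
    by (simp add: conn_sets_index_def singleton_conn_sets exact_index_singleton)
  then show ?thesis by blast
qed

lemma arc_closed_Compl:
  assumes "arc_closed G T" shows "arc_closed G (pverts G - T)"
  using assms arc_commute in_arcsD2 unfolding arc_closed_def by blast

text \<open>A nonempty arc-closed subset of D of least cardinality is a component.\<close>

lemma closed_contains_component:
  assumes "arc_closed G D" "D \<noteq> {}"
  obtains C where "C \<subseteq> D" "arc_closed G C" "C \<in> conn_sets G"
proof -
  let ?P = "\<lambda>C. C \<subseteq> D \<and> C \<noteq> {} \<and> arc_closed G C"
  obtain C where C: "?P C" and min: "\<And>T. ?P T \<Longrightarrow> card C \<le> card T"
    using ex_has_least_nat[of ?P D card] assms by blast
  have CV: "C \<subseteq> pverts G" "finite C"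
    using C pair_finite_verts by (auto simp: arc_closed_def intro: finite_subset)
  have "T = C" if T: "T \<subseteq> C" "T \<noteq> {}" "\<forall>u\<in>T. \<forall>v\<in>C. (u, v) \<in> parcs G \<longrightarrow> v \<in> T" for T
  proof -
    \<comment> \<open>C is arc-closed, so a subset that no arc within C leaves is arc-closed in the
      whole graph, and minimality applies to it.\<close>
    have "?P T" using T C CV unfolding arc_closed_def by blast
    then show ?thesis using min T(1) CV(2) by (meson card_seteq)
  qed
  then have "C \<in> conn_sets G" using C CV by (auto simp: conn_sets_iff)
  then show ?thesis using C that by blast
qed

text \<open>If v had no neighbour in S, then \<open>{v}\<close> would be cut off from the rest of
  S.\<close>

lemma conn_set_deg_pos:
  assumes "S \<in> conn_sets G" "v \<in> S" "S \<noteq> {v}"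
  shows "1 \<le> deg_in G S v"
proof (rule ccontr)
  assume "\<not> 1 \<le> deg_in G S v"
  then have "card {u \<in> S. (v, u) \<in> parcs G} = 0" unfolding deg_in_def by linarith
  moreover have "finite {u \<in> S. (v, u) \<in> parcs G}"
    using assms(1) by (intro finite_nbrs conn_setsD)
  ultimately have "{u \<in> S. (v, u) \<in> parcs G} = {}"
    using card_0_eq by blast
  moreover have "{v} = S" if "\<forall>u\<in>{v}. \<forall>w\<in>S. (u, w) \<in> parcs G \<longrightarrow> w \<in> {v}"
    using assms(1,2) that unfolding conn_sets_iff by simp
  ultimately have "{v} = S" by blast
  then show False using assms(3) by simp
qed

section \<open>Graphs of maximum degree at most two\<close>

lemma exact_index_neg_iff_singleton:
  assumes "max_deg G \<le> 2" "S \<in> conn_sets G"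
  shows "exact_index G S < 0 \<longleftrightarrow> (\<exists>v\<in>pverts G. S = {v} \<and> 1 \<le> vdeg v)"
proof
  have S: "S \<subseteq> pverts G" "S \<noteq> {}" using assms(2) by (rule conn_setsD)+
  assume neg: "exact_index G S < 0"
  obtain v where v: "v \<in> S" "S = {v}"
  proof (rule ccontr)
    assume "\<not> thesis"
    then have ns: "\<forall>v\<in>S. S \<noteq> {v}" using that by blast
    have "int (deg_in G S v) \<ge> int (deg_in G (pverts G - S) v)" if "v \<in> S" for v
    \<comment> \<open>At least one of the at most two neighbours of v lies inside S, so at most one
      lies outside.\<close>
    proof -
      have "1 \<le> deg_in G S v" using conn_set_deg_pos[OF assms(2) that] ns that by blast
      moreover have "vdeg v \<le> max_deg G" using vdeg_le_max_deg S(1) that by blast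
      ultimately show ?thesis using deg_in_split[OF S(1), of v] assms(1) by linarith
    qed
    then have "defensive_alliance G 0 S" using S by (auto simp: defensive_alliance_def)
    then show False using neg exact_index_ge_iff(1)[OF S, of 0] by simp
  qed
  then show "\<exists>v\<in>pverts G. S = {v} \<and> 1 \<le> vdeg v"
    using neg S(1) exact_index_singleton[of v] by auto
next
  assume "\<exists>v\<in>pverts G. S = {v} \<and> 1 \<le> vdeg v"
  then show "exact_index G S < 0" using exact_index_singleton by auto
qed

text \<open>Negative indices belong exactly to singletons of non-isolated vertices and are at least
  -2, so two coefficients recover the number of such vertices.\<close>

lemma card_nonisolated:
  assumes "max_deg G \<le> 2"
  shows "card {v \<in> pverts G. 1 \<le> vdeg v} =
    card (conn_sets_index G (- 1)) + card (conn_sets_index G (- 2))"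
proof -
  have "conn_sets_index G (- 1) \<union> conn_sets_index G (- 2) = {S \<in> conn_sets G. exact_index G S < 0}"
  proof -
    have "exact_index G S = - 1 \<or> exact_index G S = - 2 \<longleftrightarrow> exact_index G S < 0"
      if "S \<in> conn_sets G" for S
      using exact_index_ge_iff(2)[OF conn_setsD[OF that]] assms by linarith
    then show ?thesis unfolding conn_sets_index_def by blast
  qed
  also have "\<dots> = (\<lambda>v. {v}) ` {v \<in> pverts G. 1 \<le> vdeg v}"
    using exact_index_neg_iff_singleton[OF assms] singleton_conn_sets by blast
  finally have eq: "conn_sets_index G (- 1) \<union> conn_sets_index G (- 2) = \<dots>" .
  have "card (conn_sets_index G (- 1) \<union> conn_sets_index G (- 2)) =
      card (conn_sets_index G (- 1)) + card (conn_sets_index G (- 2))"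
    using finite_conn_sets by (intro card_Un_disjoint) (auto simp: conn_sets_index_def)
  then show ?thesis unfolding eq by (simp add: card_image)
qed

text \<open>A neighbour outside S would require at least two inside, hence degree at least
  three.\<close>

lemma exact_index_pos_imp_closed:
  assumes "max_deg G \<le> 2" "S \<subseteq> pverts G" "S \<noteq> {}" "1 \<le> exact_index G S"
  shows "arc_closed G S"
  unfolding arc_closed_def
proof (intro conjI ballI allI impI)
  fix u v assume u: "u \<in> S" and uv: "(u, v) \<in> parcs G"
  have "int (deg_in G S u) \<ge> int (deg_in G (pverts G - S) u) + 1"
    using assms u exact_index_ge_iff(1)[of S 1] by (auto simp: defensive_alliance_def)
  then have "deg_in G (pverts G - S) u = 0"
    using deg_in_split[OF assms(2), of u] vdeg_le_max_deg[of u] assms(1,2) u by fastforce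
  then have "{w \<in> pverts G - S. (u, w) \<in> parcs G} = {}"
    using finite_nbrs[of "pverts G - S" u] by (auto simp: deg_in_def)
  then show "v \<in> S" using uv in_arcsD2 by blast
qed (use assms in auto)

lemma conn_sets_index_pos:
  assumes "max_deg G \<le> 2" "pverts G \<in> conn_sets G" "1 \<le> k" "S \<in> conn_sets_index G k"
  shows "S = pverts G"
  using assms exact_index_pos_imp_closed[of S] verts_conn_sets_iff conn_setsD[of S G]
  by (simp add: conn_sets_index_def)

section \<open>Walking along a path from a leaf\<close>

lemma partial_path_nbr:
  fixes f :: "nat \<Rightarrow> 'a"
  assumes deg: "\<And>v. v \<in> pverts G \<Longrightarrow> vdeg v \<le> 2" and leaf: "vdeg (f 0) = 1"
    and inj: "inj_on f {..m}" and V: "f ` {..m} \<subseteq> pverts G"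
    and arcs: "\<And>i. i < m \<Longrightarrow> (f i, f (Suc i)) \<in> parcs G"
    and i: "i < m" and x: "(f i, x) \<in> parcs G"
  shows "x = f (Suc i) \<or> 0 < i \<and> x = f (i - 1)"
proof -
  \<comment> \<open>These are the neighbours of \<open>f i\<close> on the path: one at the leaf, two
    further along. They exhaust its degree, so the path can only be left at its last vertex
    \<open>f m\<close>.\<close>
  define A where "A = insert (f (Suc i)) (if i = 0 then {} else {f (i - 1)})"
  let ?N = "{u \<in> pverts G. (f i, u) \<in> parcs G}"
  have "(f i, f (i - 1)) \<in> parcs G" if "0 < i"
    using arcs[of "i - 1"] i that arc_commute by auto
  then have sub: "A \<subseteq> ?N" using arcs[OF i] in_arcsD2 by (auto simp: A_def split: if_splits)
  have "f (Suc i) \<noteq> f (i - 1)" using inj i by (auto dest!: inj_onD)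
  then have "card A = (if i = 0 then 1 else 2)" by (auto simp: A_def)
  moreover have "f i \<in> pverts G" using V i by (simp add: image_subset_iff)
  then have "card ?N \<le> (if i = 0 then 1 else 2)"
    using leaf deg by (simp add: deg_in_def)
  ultimately have "A = ?N" using sub finite_nbrs by (intro card_seteq) auto
  then have "x \<in> A" using x in_arcsD2 by blast
  then show ?thesis by (auto simp: A_def split: if_splits)
qed

text \<open>As long as the path misses a vertex, connectedness yields an arc leaving it. By
  \<open>partial_path_nbr\<close> this arc starts at the last vertex, so it prolongs the
  path.\<close>

lemma partial_path_exists:
  assumes con: "pverts G \<in> conn_sets G"
    and deg: "\<And>v. v \<in> pverts G \<Longrightarrow> vdeg v \<le> 2" and leaf: "v0 \<in> pverts G" "vdeg v0 = 1"
    and "m < card (pverts G)"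
  shows "\<exists>f. inj_on f {..m} \<and> f ` {..m} \<subseteq> pverts G \<and> f 0 = v0 \<and>
    (\<forall>i<m. (f i, f (Suc i)) \<in> parcs G)"
  using \<open>m < card (pverts G)\<close>
proof (induction m)
  case 0
  show ?case using leaf by (intro exI[of _ "\<lambda>_. v0"]) auto
next
  case (Suc m)
  then obtain f where f: "inj_on f {..m}" "f ` {..m} \<subseteq> pverts G" "f 0 = v0"
      "\<forall>i<m. (f i, f (Suc i)) \<in> parcs G" by auto
  have "card (f ` {..m}) = Suc m" using f(1) by (simp add: card_image)
  then have "f ` {..m} \<noteq> pverts G" using Suc.prems by auto
  moreover have "f ` {..m} \<noteq> {}" by simp
  ultimately have "\<not> arc_closed G (f ` {..m})" using con verts_conn_sets_iff by metis
  then obtain i x where i: "i \<le> m" and x: "(f i, x) \<in> parcs G" "x \<notin> f ` {..m}"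
    using f(2) unfolding arc_closed_def by (metis (no_types, lifting) atMost_iff imageE)
  have "i = m"
  proof (rule ccontr)
    assume "i \<noteq> m"
    then have "x = f (Suc i) \<or> 0 < i \<and> x = f (i - 1)"
      using partial_path_nbr[OF deg _ f(1,2) _ _ x(1)] f(3,4) leaf i by auto
    then show False using x(2) i \<open>i \<noteq> m\<close> by auto
  qed
  define g where "g = f(Suc m := x)"
  have g: "g i = f i" if "i \<le> m" for i using that by (auto simp: g_def)
  have img: "g ` {..m} = f ` {..m}" using g by auto
  have "inj_on g {..m}" using f(1) g by (auto simp: inj_on_def)
  then have "inj_on g {..Suc m}" using img x(2) by (auto simp: atMost_Suc g_def)
  moreover have "g ` {..Suc m} \<subseteq> pverts G"
    using img f(2) in_arcsD2[OF x(1)] by (auto simp: atMost_Suc g_def)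
  moreover have "\<forall>i<Suc m. (g i, g (Suc i)) \<in> parcs G"
    using f(4) x(1) \<open>i = m\<close> by (auto simp: g_def less_Suc_eq)
  ultimately show ?case using g[of 0] f(3) by auto
qed

lemma path_enumeration:
  assumes con: "pverts G \<in> conn_sets G"
    and deg: "\<And>v. v \<in> pverts G \<Longrightarrow> vdeg v \<le> 2" and leaf: "v0 \<in> pverts G" "vdeg v0 = 1"
  obtains f where "bij_betw f {..<card (pverts G)} (pverts G)"
    "\<And>i j. i < card (pverts G) \<Longrightarrow> j < card (pverts G) \<Longrightarrow>
      (f i, f j) \<in> parcs G \<longleftrightarrow> j = Suc i \<or> i = Suc j"
proof -
  let ?n = "card (pverts G)"
  define m where "m = ?n - 1"
  have "0 < ?n" using leaf(1) pair_finite_verts by (auto simp: card_gt_0_iff)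
  then have n: "?n = Suc m" by (simp add: m_def)
  obtain f where f: "inj_on f {..m}" "f ` {..m} \<subseteq> pverts G" "f 0 = v0"
      "\<forall>i<m. (f i, f (Suc i)) \<in> parcs G"
    using partial_path_exists[OF con deg leaf, of m] n by auto
  have "f ` {..m} = pverts G"
    using f(1,2) pair_finite_verts n by (intro card_seteq) (auto simp: card_image)
  then have "bij_betw f {..<?n} (pverts G)"
    using f(1) n by (simp add: bij_betw_def lessThan_Suc_atMost)
  moreover have "(f i, f j) \<in> parcs G \<longleftrightarrow> j = Suc i \<or> i = Suc j"
    if "i < ?n" "j < ?n" for i j
  proof
    \<comment> \<open>An arc to a later index starts before the end of the path, so
      \<open>partial_path_nbr\<close> applies and excludes chords. The endpoint \<open>f m\<close>
      is reached by swapping i and j.\<close>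
    have up: "j = Suc i" if "(f i, f j) \<in> parcs G" "i < j" "j \<le> m" for i j
    proof -
      have "f j = f (Suc i) \<or> 0 < i \<and> f j = f (i - 1)"
        using partial_path_nbr[OF deg _ f(1,2) _ _ that(1)] f(3,4) leaf that by auto
      then show ?thesis using inj_onD[OF f(1)] that by fastforce
    qed
    assume a: "(f i, f j) \<in> parcs G"
    then have "i \<noteq> j" using no_loops' by blast
    then show "j = Suc i \<or> i = Suc j"
      using up[of i j] up[of j i] a arc_commute[of "f i" "f j"] that n
      by (cases i j rule: linorder_cases) auto
  next
    assume "j = Suc i \<or> i = Suc j"
    then show "(f i, f j) \<in> parcs G" using f(4) that n arc_commute by auto
  qed
  ultimately show ?thesis using that by blast
qed

lemma iso_path_graph:
  assumes con: "pverts G \<in> conn_sets G"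
    and deg: "\<And>v. v \<in> pverts G \<Longrightarrow> vdeg v \<le> 2" and leaf: "v0 \<in> pverts G" "vdeg v0 = 1"
  shows "digraph_iso (with_proj G) (with_proj (path_graph (card (pverts G))))"
proof -
  let ?n = "card (pverts G)"
  obtain f where f: "bij_betw f {..<?n} (pverts G)"
    "\<And>i j. i < ?n \<Longrightarrow> j < ?n \<Longrightarrow> (f i, f j) \<in> parcs G \<longleftrightarrow> j = Suc i \<or> i = Suc j"
    using path_enumeration[OF assms] by blast
  define h where "h = the_inv_into {..<?n} f"
  have h: "bij_betw h (pverts G) {..<?n}" using f(1) by (simp add: h_def bij_betw_the_inv_into)
  have hf: "h (f i) = i" if "i < ?n" for i
    using f(1) that by (simp add: h_def bij_betw_def the_inv_into_f_f)
  have fh: "f (h v) = v" if "v \<in> pverts G" for v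
    using f(1) that by (simp add: h_def bij_betw_def f_the_inv_into_f)
  have hn: "h v < ?n" if "v \<in> pverts G" for v using h that by (auto dest: bij_betwE)
  have arcs: "map_prod h h ` parcs G = parcs (path_graph ?n)"
  proof (intro set_eqI iffI)
    fix e assume "e \<in> map_prod h h ` parcs G"
    then obtain u v where uv: "(u, v) \<in> parcs G" "e = (h u, h v)" by auto
    then have "u \<in> pverts G" "v \<in> pverts G" by (auto dest: in_arcsD1 in_arcsD2)
    then show "e \<in> parcs (path_graph ?n)"
      using f(2)[of "h u" "h v"] uv fh hn by (auto simp: path_graph_def)
  next
    fix e assume "e \<in> parcs (path_graph ?n)"
    then obtain i j where ij: "e = (i, j)" "i < ?n" "j < ?n" "j = Suc i \<or> i = Suc j"
      by (auto simp: path_graph_def)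
    then have "(f i, f j) \<in> parcs G" using f(2) by blast
    moreover have "e = map_prod h h (f i, f j)" using ij(1-3) hf by simp
    ultimately show "e \<in> map_prod h h ` parcs G" by (rule rev_image_eqI)
  qed
  \<comment> \<open>Arcs are pairs of vertices, so h acts on them componentwise, and the head and
    tail maps of the image are again the projections.\<close>
  define \<phi> where "\<phi> = \<lparr>iso_verts = h, iso_arcs = map_prod h h,
    iso_head = snd, iso_tail = (fst :: nat \<times> nat \<Rightarrow> nat)\<rparr>"
  have inj: "inj_on h (pverts G)" using h by (simp add: bij_betw_def)
  have "inj_on (map_prod h h) (parcs G)"
    by (rule inj_on_subset[OF map_prod_inj_on[OF inj inj]]) (auto dest: in_arcsD1 in_arcsD2)
  then have "digraph_isomorphism \<phi>"
    using inj wf_digraph_axioms by (auto simp: digraph_isomorphism_def \<phi>_def)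
  moreover have "with_proj (path_graph ?n) = app_iso \<phi> (with_proj G)"
    using h arcs by (auto simp: app_iso_def \<phi>_def with_proj_def bij_betw_def path_graph_def)
  ultimately show ?thesis unfolding digraph_iso_def by blast
qed

end

section \<open>The path graph\<close>

lemma pair_graph_path_graph: "pair_graph (path_graph t)"
proof
  show "finite (parcs (path_graph t))"
    by (rule finite_subset[of _ "{..<t} \<times> {..<t}"]) (auto simp: path_graph_def)
qed (auto simp: path_graph_def symmetric_def arcs_ends_conv sym_def)

lemma deg_path_graph_bounds:
  assumes "t \<ge> 2" "v < t"
  shows "1 \<le> deg_in (path_graph t) (pverts (path_graph t)) v"
    and "deg_in (path_graph t) (pverts (path_graph t)) v \<le> 2"
    and "deg_in (path_graph t) (pverts (path_graph t)) 0 = 1"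
proof -
  let ?N = "\<lambda>v. {u \<in> {..<t}. (v, u) \<in> parcs (path_graph t)}"
  have V: "pverts (path_graph t) = {..<t}" by (simp add: path_graph_def)
  have fin: "finite (?N v)" for v by auto
  \<comment> \<open>The last vertex has no successor, but it has a predecessor because t \<ge>
    2.\<close>
  have "(if Suc v < t then Suc v else v - 1) \<in> ?N v"
    using assms by (auto simp: path_graph_def)
  then show "1 \<le> deg_in (path_graph t) (pverts (path_graph t)) v"
    unfolding deg_in_def V using fin by (metis One_nat_def Suc_leI card_gt_0_iff empty_iff)
  \<comment> \<open>For v = 0 truncated subtraction gives \<open>v - 1 = 0\<close>, which is no
    neighbour; the inclusion still holds.\<close>
  have "?N v \<subseteq> {Suc v, v - 1}" by (auto simp: path_graph_def)
  then have "card (?N v) \<le> card {Suc v, v - 1}" by (intro card_mono) auto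
  also have "\<dots> \<le> 2" by (simp add: card_insert_le_m1)
  finally show "deg_in (path_graph t) (pverts (path_graph t)) v \<le> 2"
    unfolding deg_in_def V .
  have "?N 0 = {1}" using assms by (auto simp: path_graph_def)
  then show "deg_in (path_graph t) (pverts (path_graph t)) 0 = 1"
    unfolding deg_in_def V by simp
qed

lemma path_graph_connected:
  assumes "t \<ge> 1"
  shows "pverts (path_graph t) \<in> conn_sets (path_graph t)"
proof -
  interpret pair_graph "path_graph t" by (rule pair_graph_path_graph)
  have "T = pverts (path_graph t)" if T: "T \<noteq> {}" "arc_closed (path_graph t) T" for T
  proof -
    have cl: "j \<in> T" if "i \<in> T" "i < t" "j < t" "j = Suc i \<or> i = Suc j" for i j
      using T(2) that by (auto simp: arc_closed_def path_graph_def)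
    have sub: "T \<subseteq> {..<t}" using T(2) by (auto simp: arc_closed_def path_graph_def)
    obtain k where k: "k \<in> T" "k < t" using T(1) sub by auto
    \<comment> \<open>From any of its members a closed set reaches 0 by descending, and then every
      vertex by ascending.\<close>
    have "0 \<in> T"
      using k by (induction k) (use cl in auto)
    have "i < t \<Longrightarrow> i \<in> T" for i
      by (induction i) (use \<open>0 \<in> T\<close> cl in auto)
    then show ?thesis using sub by (auto simp: path_graph_def)
  qed
  moreover have "pverts (path_graph t) \<noteq> {}"
    using assms by (simp add: path_graph_def lessThan_empty_iff)
  ultimately show ?thesis unfolding verts_conn_sets_iff by blast
qed

section \<open>Comparison of the two polynomials\<close>

theorem theorem3p3:
  fixes t :: nat and \<Gamma> :: "'a pair_pre_digraph"
  assumes "t \<ge> 2"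
    and "pair_graph \<Gamma>" and "pverts \<Gamma> \<noteq> {}"
    and "alliance_poly \<Gamma> = alliance_poly (path_graph t)"
  shows "digraph_iso (with_proj \<Gamma>) (with_proj (path_graph t))"
proof -
  let ?P = "path_graph t"
  let ?n = "card (pverts \<Gamma>)"
  interpret G: pair_graph \<Gamma> by (rule assms)
  interpret P: pair_graph ?P by (rule pair_graph_path_graph)
  have VP: "pverts ?P = {..<t}" by (simp add: path_graph_def)
  then have cardP: "card (pverts ?P) = t" and neP: "pverts ?P \<noteq> {}" using assms(1) by (auto simp: lessThan_empty_iff)
  note degP = deg_path_graph_bounds[OF assms(1)]
  have conP: "pverts ?P \<in> conn_sets ?P" using assms(1) by (intro path_graph_connected) simp

  \<comment> \<open>Families are matched by the exponent e, since the orders may still differ and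
    indices need not correspond. For negative e both families are empty because \<Delta> is less
    than the order.\<close>
  have same: "card (conn_sets_index \<Gamma> (e - int ?n)) = card (conn_sets_index ?P (e - int t))" for e
  proof (cases "e \<ge> 0")
    case True
    then show ?thesis
      using arg_cong[OF assms(4), of "\<lambda>p. coeff p (nat e)"]
      by (simp add: G.coeff_alliance_poly P.coeff_alliance_poly cardP)
  next
    case False
    then have "conn_sets_index \<Gamma> (e - int ?n) = {}" "conn_sets_index ?P (e - int t) = {}"
      using G.max_deg_less_card[OF assms(3)] P.max_deg_less_card[OF neP] cardP
      by (intro G.conn_sets_index_empty P.conn_sets_index_empty; linarith)+
    then show ?thesis by simp
  qed
  have finG: "finite (conn_sets_index \<Gamma> k)" and finP: "finite (conn_sets_index ?P k)" for k
    using G.finite_conn_sets P.finite_conn_sets by (auto simp: conn_sets_index_def)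
  have same_empty: "conn_sets_index \<Gamma> (e - int ?n) = {} \<longleftrightarrow> conn_sets_index ?P (e - int t) = {}" for e
    using same[of e] finG finP by (metis card_eq_0_iff)

  have dP: "1 \<le> max_deg ?P" "max_deg ?P \<le> 2"
    using P.max_deg_attained[OF neP] degP VP by (metis lessThan_iff)+
  have clP: "arc_closed ?P (pverts ?P)" using P.in_arcsD2 by (auto simp: arc_closed_def)
  \<comment> \<open>The index of the whole vertex set is the minimum degree, which the end vertex 0
    attains.\<close>
  have idxP: "exact_index ?P (pverts ?P) = 1"
  proof -
    have "k \<le> exact_index ?P (pverts ?P) \<longleftrightarrow> k \<le> 1" for k
      unfolding P.exact_index_closed[OF clP neP] using degP VP assms(1) by force
    then show ?thesis by (meson order_antisym order_refl)
  qed
  \<comment> \<open>This fact and the next say that the leading monomial of the path's polynomial is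
    x^(t+1), with coefficient 1.\<close>
  have P1: "conn_sets_index ?P 1 = {pverts ?P}"
  proof -
    have "pverts ?P \<in> conn_sets_index ?P 1" using conP idxP by (simp add: conn_sets_index_def)
    moreover have "S = pverts ?P" if "S \<in> conn_sets_index ?P 1" for S
      by (rule P.conn_sets_index_pos[OF dP(2) conP _ that]) simp
    ultimately show ?thesis by blast
  qed
  have P2: "conn_sets_index ?P k = {}" if k: "2 \<le> k" for k
  proof (rule equals0I)
    fix S assume S: "S \<in> conn_sets_index ?P k"
    have "S = pverts ?P" by (rule P.conn_sets_index_pos[OF dP(2) conP _ S]) (use k in simp)
    then show False using S idxP k by (simp add: conn_sets_index_def)
  qed

  note lowP = P.conn_sets_index_lowest[OF neP] and lowG = G.conn_sets_index_lowest[OF assms(3)]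

  \<comment> \<open>Each inequality reads the lowest nonzero coefficient of one polynomial in the
    other.\<close>
  have low: "int ?n - int (max_deg \<Gamma>) = int t - int (max_deg ?P)"
  proof (rule order_antisym)
    have "conn_sets_index \<Gamma> (int t - int (max_deg ?P) - int ?n) \<noteq> {}"
      using lowP same_empty[of "int t - int (max_deg ?P)"] by simp
    then show "int ?n - int (max_deg \<Gamma>) \<le> int t - int (max_deg ?P)"
      using G.conn_sets_index_empty[of "int t - int (max_deg ?P) - int ?n"] by linarith
    have "conn_sets_index ?P (int ?n - int (max_deg \<Gamma>) - int t) \<noteq> {}"
      using lowG same_empty[of "int ?n - int (max_deg \<Gamma>)"] by simp
    then show "int t - int (max_deg ?P) \<le> int ?n - int (max_deg \<Gamma>)"
      using P.conn_sets_index_empty[of "int ?n - int (max_deg \<Gamma>) - int t"] by linarith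
  qed
  have top: "int t + 1 \<le> int ?n + int (max_deg \<Gamma>)"
  proof -
    have "conn_sets_index \<Gamma> (int t + 1 - int ?n) \<noteq> {}"
      using P1 same_empty[of "int t + 1"] by simp
    then show ?thesis using G.conn_sets_index_empty[of "int t + 1 - int ?n"] by linarith
  qed
  have "?n \<le> t"
  proof -
    \<comment> \<open>A component inside the set of non-isolated vertices has minimum degree at
      least 1, so it yields an exponent of at least n + 1, whereas the path allows at most t +
      1.\<close>
    define D where "D = {v \<in> pverts \<Gamma>. 1 \<le> G.vdeg v}"
    have inD: "u \<in> D" if "(u, v) \<in> parcs \<Gamma>" for u v
    proof -
      have "{w \<in> pverts \<Gamma>. (u, w) \<in> parcs \<Gamma>} \<noteq> {}" using that G.in_arcsD2 by auto
      then have "1 \<le> G.vdeg u"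
        unfolding deg_in_def using G.finite_nbrs[of "pverts \<Gamma>" u] by (simp add: Suc_le_eq card_gt_0_iff)
      then show ?thesis using that G.in_arcsD1 by (auto simp: D_def)
    qed
    have "arc_closed \<Gamma> D"
      unfolding arc_closed_def using inD G.arc_commute by (auto simp: D_def)
    moreover have "D \<noteq> {}"
    proof -
      \<comment> \<open>Eliminating n from \<open>top\<close> and \<open>low\<close> gives 2
        \<Delta>(\<Gamma>) \<ge> \<Delta>(P) + 1 \<ge> 2.\<close>
      have "1 \<le> max_deg \<Gamma>" using top low dP(1) by linarith
      then show ?thesis using G.max_deg_attained[OF assms(3)] unfolding D_def
        by (metis (mono_tags, lifting) empty_Collect_eq)
    qed
    ultimately obtain C where C: "C \<subseteq> D" "arc_closed \<Gamma> C" "C \<in> conn_sets \<Gamma>"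
      by (rule G.closed_contains_component)
    then have "C \<noteq> {}" by (intro conn_setsD)
    then have idx: "1 \<le> exact_index \<Gamma> C"
      using C(1) G.exact_index_closed[OF C(2), of 1] by (auto simp: D_def)
    have "conn_sets_index \<Gamma> (exact_index \<Gamma> C) \<noteq> {}" using C(3) by (auto simp: conn_sets_index_def)
    then have "conn_sets_index ?P (int ?n + exact_index \<Gamma> C - int t) \<noteq> {}"
      using same_empty[of "int ?n + exact_index \<Gamma> C"] by simp
    then have "int ?n + exact_index \<Gamma> C - int t < 2" using P2 by force
    then show ?thesis using idx by linarith
  qed
  \<comment> \<open>Eliminating \<Delta>(\<Gamma>) gives 2t + 1 \<le> 2n + \<Delta>(P) \<le> 2n + 2,
    and integrality gives t \<le> n.\<close>
  moreover have "t \<le> ?n" using top low dP by linarith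
  ultimately have n: "?n = t" by simp
  then have dG: "max_deg \<Gamma> \<le> 2" using low dP by linarith
  have same': "card (conn_sets_index \<Gamma> k) = card (conn_sets_index ?P k)" for k
    using same[of "k + int t"] n by simp

  have "card {v \<in> pverts \<Gamma>. 1 \<le> G.vdeg v} = card {v \<in> pverts ?P. 1 \<le> P.vdeg v}"
    unfolding G.card_nonisolated[OF dG] P.card_nonisolated[OF dP(2)] by (simp add: same')
  also have "{v \<in> pverts ?P. 1 \<le> P.vdeg v} = pverts ?P" using degP VP by auto
  finally have "{v \<in> pverts \<Gamma>. 1 \<le> G.vdeg v} = pverts \<Gamma>"
    using n cardP G.pair_finite_verts by (intro card_seteq) auto
  then have pos: "1 \<le> G.vdeg v" if "v \<in> pverts \<Gamma>" for v using that by blast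

  obtain S where G1: "conn_sets_index \<Gamma> 1 = {S}"
    using same'[of 1] P1 by (auto simp: card_1_singleton_iff)
  have G2: "conn_sets_index \<Gamma> 2 = {}" using same'[of 2] P2[of 2] finG by simp
  \<comment> \<open>Without isolated vertices, a component has index 1 or 2. Index 2 does not occur,
    and S is the only connected set of index 1.\<close>
  have component: "C = S" if C: "arc_closed \<Gamma> C" "C \<in> conn_sets \<Gamma>" for C
  proof -
    have CV: "C \<noteq> {}" "C \<subseteq> pverts \<Gamma>" using C(2) by (auto dest: conn_setsD)
    then have "1 \<le> exact_index \<Gamma> C" using pos by (subst G.exact_index_closed[OF C(1)]) auto
    moreover have "exact_index \<Gamma> C \<le> 2" using G.exact_index_ge_iff(3)[OF CV(2,1)] dG by linarith
    moreover have "exact_index \<Gamma> C \<noteq> 2" using G2 C(2) by (auto simp: conn_sets_index_def)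
    ultimately have "C \<in> conn_sets_index \<Gamma> 1" using C(2) by (simp add: conn_sets_index_def)
    then show ?thesis using G1 by simp
  qed
  have conG: "pverts \<Gamma> \<in> conn_sets \<Gamma>"
    unfolding G.verts_conn_sets_iff
  proof (intro conjI allI impI)
    fix T assume T: "T \<noteq> {}" "arc_closed \<Gamma> T"
    show "T = pverts \<Gamma>"
    proof (rule ccontr)
      assume "T \<noteq> pverts \<Gamma>"
      then have "pverts \<Gamma> - T \<noteq> {}" using T(2) by (auto simp: arc_closed_def)
      \<comment> \<open>A component in T and one in its complement would both equal S, although they
        are disjoint and nonempty.\<close>
      then obtain C' where C': "C' \<subseteq> pverts \<Gamma> - T" "arc_closed \<Gamma> C'" "C' \<in> conn_sets \<Gamma>"
        using G.closed_contains_component[OF G.arc_closed_Compl[OF T(2)]] by blast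
      obtain C where C: "C \<subseteq> T" "arc_closed \<Gamma> C" "C \<in> conn_sets \<Gamma>"
        using G.closed_contains_component[OF T(2,1)] by blast
      have "C = C'" using component C C' by blast
      moreover have "C \<noteq> {}" using C(3) by (rule conn_setsD)
      ultimately show False using C(1) C'(1) by blast
    qed
  qed (rule assms(3))
  have clG: "arc_closed \<Gamma> (pverts \<Gamma>)" using G.in_arcsD2 by (auto simp: arc_closed_def)
  \<comment> \<open>The connected graph is itself the component of index 1, so its minimum degree is
    1; this provides the leaf at which the path starts.\<close>
  then have "pverts \<Gamma> \<in> conn_sets_index \<Gamma> 1" using component conG G1 by auto
  then have "\<not> 2 \<le> exact_index \<Gamma> (pverts \<Gamma>)" by (simp add: conn_sets_index_def)
  then obtain v0 where "v0 \<in> pverts \<Gamma>" "\<not> 2 \<le> G.vdeg v0"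
    unfolding G.exact_index_closed[OF clG assms(3)] by auto
  then have v0: "v0 \<in> pverts \<Gamma>" "G.vdeg v0 = 1" using pos[of v0] by auto
  have "G.vdeg v \<le> 2" if "v \<in> pverts \<Gamma>" for v using G.vdeg_le_max_deg[OF that] dG by linarith
  then show ?thesis using G.iso_path_graph[OF conG _ v0] n by simp
qed

end
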